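(* Let $k$, $t$ and $\lambda$ be fixed positive integers such that $k \geq t+2$ and $t\geq 2$, and let $\alpha$ be a fixed positive constant such that \[ \alpha<\left(\frac{(k-1)(k-2)\cdots(k-t)}{\lambda(2^{t+1}-1)}\right)^{1/t}. \] Then for all sufficiently large $n$, every partial $(n,k,t)_\lambda$-system has a cyclically $\ell$-good sequencing for each positive integer $\ell \leq \alpha n^{1/t}$.
   Context: For positive integers $n,k,t,\lambda$ with $n \geq k > t \geq 2$, a partial $(n,k,t)_\lambda$-system is a pair $(X,\mathcal{B})$ where $X$ is an $n$-set of vertices and $\mathcal{B}$ is a collection of $k$-subsets of $X$ (blocks) such that each $t$-subset of $X$ is contained in at most $\lambda$ blocks. An independent set is a subset $Y\subseteq X$ containing no block. Let $\mathbb{Z}_n=\{0,\ldots,n-1\}$ be the cyclic group of order $n$. A sequencing is a bijection $\varphi:\mathbb{Z}_n\to X$. A set $S\subseteq X$ is cyclically consecutive if $S=\{\varphi(i),\varphi(i+1),\ldots,\varphi(i+|S|-1)\}$ for some $i\in\mathbb{Z}_n$ (addition in $\mathbb{Z}_n$). For a positive integer $\ell$, a sequencing is cyclically $\ell$-good if every set of $\ell$ cyclically consecutive vertices is an independent set. *)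

theory Defs
  imports Complex_Main
begin

definition partial_system :: "nat \<Rightarrow> nat \<Rightarrow> nat \<Rightarrow> nat \<Rightarrow> 'a set \<Rightarrow> 'a set set \<Rightarrow> bool" where
  "partial_system n k t lam X B \<longleftrightarrow>
     0 < lam \<and> 2 \<le> t \<and> t < k \<and> k \<le> n \<and>
     finite X \<and> card X = n \<and>
     (\<forall>b\<in>B. b \<subseteq> X \<and> card b = k) \<and>
     (\<forall>T. T \<subseteq> X \<and> card T = t \<longrightarrow> card {b\<in>B. T \<subseteq> b} \<le> lam)"

definition independent_set :: "'a set \<Rightarrow> 'a set set \<Rightarrow> 'a set \<Rightarrow> bool" where
  "independent_set X B Y \<longleftrightarrow> Y \<subseteq> X \<and> (\<forall>b\<in>B. \<not> b \<subseteq> Y)"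

definition sequencing :: "nat \<Rightarrow> 'a set \<Rightarrow> (nat \<Rightarrow> 'a) \<Rightarrow> bool" where
  "sequencing n X \<phi> \<longleftrightarrow> bij_betw \<phi> {0..<n} X"

definition cyc_window :: "nat \<Rightarrow> (nat \<Rightarrow> 'a) \<Rightarrow> nat \<Rightarrow> nat \<Rightarrow> 'a set" where
  "cyc_window n \<phi> i l = \<phi> ` {(i + j) mod n | j. j < l}"

definition cyclically_good :: "nat \<Rightarrow> 'a set \<Rightarrow> 'a set set \<Rightarrow> (nat \<Rightarrow> 'a) \<Rightarrow> nat \<Rightarrow> bool" where
  "cyclically_good n X B \<phi> l \<longleftrightarrow>
     sequencing n X \<phi> \<and> (\<forall>i<n. independent_set X B (cyc_window n \<phi> i l))"

end

theory Submission
  imports Defs "HOL-Combinatorics.Permutations"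
begin

text \<open>The idea is to apply the lopsided Lovasz local lemma to a uniformly random sequencing. The
  bad events say that a given block occupies a given set of positions inside a window; each has
  probability 1 / (n choose k), and events with disjoint blocks and disjoint position sets are
  negatively dependent in the sense required. A bad event has $O(n^t \ell^{k-1})$ neighbours, which
  for $\ell = O(n^{1/t})$ is $o(n^k)$ because $k \geq t + 2$.\<close>

section \<open>Lopsided Lovasz local lemma, counting form\<close>

text \<open>Cardinalities stand for probabilities under the uniform measure on
  \<open>\<Omega>\<close>. Instead of independence, \<open>lop\<close> asks only that avoiding any
  non-neighbours of \<open>i\<close> keeps the conditional probability of \<open>A i\<close> at most
  \<open>p\<close>.\<close>

lemma lopsided_local_lemma:
  fixes A :: "'i \<Rightarrow> 'b set" and nb :: "'i \<Rightarrow> 'i set" and p :: real and d :: nat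
  assumes fin: "finite \<Omega>" "\<Omega> \<noteq> {}" "finite I"
    and p: "0 \<le> p" "0 < d" "4 * p * d \<le> 1"
    and lop: "\<And>i S. i \<in> I \<Longrightarrow> S \<subseteq> I - nb i \<Longrightarrow>
      card (A i \<inter> (\<Omega> - \<Union>(A ` S))) \<le> p * card (\<Omega> - \<Union>(A ` S))"
    and deg: "\<And>i. i \<in> I \<Longrightarrow> card (nb i \<inter> I) \<le> d"
  shows "\<Omega> - \<Union>(A ` I) \<noteq> {}"
proof -
  define W where "W S = \<Omega> - \<Union>(A ` S)" for S
  have finW [simp]: "finite (W S)" for S
    using fin by (simp add: W_def)
  \<comment> \<open>Given that all events of \<open>S\<close> are avoided, each event has
    conditional probability at most 2p. The product form spares a case distinction on whether
    \<open>W S\<close> is empty.\<close>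
  have cond: "\<forall>i\<in>I. card (A i \<inter> W S) \<le> 2 * p * card (W S)" if "S \<subseteq> I" for S
    using finite_subset[OF that fin(3)] that
  proof (induction S rule: finite_psubset_induct)
    case (psubset S)
    show ?case
    proof
      fix i assume i: "i \<in> I"
      define S1 S2 where "S1 = S \<inter> nb i" and "S2 = S - nb i"
      have lopS2: "card (A i \<inter> W S2) \<le> p * card (W S2)"
        unfolding W_def by (rule lop) (use i psubset.prems S2_def in auto)
      show "card (A i \<inter> W S) \<le> 2 * p * card (W S)"
      proof (cases "S1 = {}")
        case True
        then have "S2 = S" by (auto simp: S1_def S2_def)
        moreover have "0 \<le> p * card (W S)" using p by simp
        ultimately show ?thesis using lopS2 by simp
      next
        case False
        then have "S2 \<subset> S" by (auto simp: S1_def S2_def)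
        with psubset.IH psubset.prems
        have IH: "\<forall>j\<in>I. card (A j \<inter> W S2) \<le> 2 * p * card (W S2)" by auto
        have finS1: "finite S1" using psubset.hyps by (simp add: S1_def)
        have "card S1 \<le> card (nb i \<inter> I)"
          using psubset.prems fin(3) by (intro card_mono) (auto simp: S1_def)
        then have S1d: "card S1 \<le> d" using deg[OF i] by simp
        \<comment> \<open>Passing from \<open>W S2\<close> to \<open>W S\<close> loses only points
          of the neighbouring events in \<open>S1\<close>. There are at most \<open>d\<close> of
          them, each taking at most a fraction 2p of \<open>W S2\<close> by induction, so at least
          half of \<open>W S2\<close> survives. This factor 2 is what turns \<open>p\<close> into
          2p.\<close>
        have "W S2 \<subseteq> W S \<union> (\<Union>j\<in>S1. A j \<inter> W S2)"
          by (auto simp: W_def S1_def S2_def)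
        then have "card (W S2) \<le> card (W S \<union> (\<Union>j\<in>S1. A j \<inter> W S2))"
          using finS1 by (intro card_mono) auto
        also have "\<dots> \<le> card (W S) + card (\<Union>j\<in>S1. A j \<inter> W S2)"
          by (rule card_Un_le)
        also have "\<dots> \<le> card (W S) + (\<Sum>j\<in>S1. card (A j \<inter> W S2))"
          by (intro add_left_mono card_UN_le finS1)
        finally have "real (card (W S2)) \<le> card (W S) + (\<Sum>j\<in>S1. real (card (A j \<inter> W S2)))"
          by (metis of_nat_add of_nat_le_iff of_nat_sum)
        also have "\<dots> \<le> card (W S) + (\<Sum>j\<in>S1. 2 * p * card (W S2))"
          using IH psubset.prems by (intro add_left_mono sum_mono) (auto simp: S1_def)
        also have "\<dots> = card (W S) + card S1 * (2 * p * card (W S2))"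
          by simp
        also have "\<dots> \<le> card (W S) + d * (2 * p * card (W S2))"
          using S1d p by (intro add_left_mono mult_right_mono) auto
        also have "\<dots> = card (W S) + (4 * p * d) * (card (W S2) / 2)"
          by simp
        also have "\<dots> \<le> card (W S) + 1 * (card (W S2) / 2)"
          using p by (intro add_left_mono mult_right_mono) auto
        finally have half: "real (card (W S2)) \<le> 2 * card (W S)" by simp
        have "card (A i \<inter> W S) \<le> card (A i \<inter> W S2)"
          using fin by (intro card_mono) (auto simp: W_def S2_def)
        then have "real (card (A i \<inter> W S)) \<le> p * card (W S2)"
          using lopS2 by linarith
        also have "\<dots> \<le> p * (2 * card (W S))"
          using half p by (intro mult_left_mono) auto
        finally show ?thesis by simp
      qed
    qed
  qed
  \<comment> \<open>Since d is at least 1, 2p is at most 1/2, so each further event to be avoided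
    removes at most half of what is left.\<close>
  have "4 * p \<le> 4 * p * d" using p by (simp add: mult_le_cancel_left1)
  then have "4 * p \<le> 1" using p by linarith
  have "card (W S) > 0" if "S \<subseteq> I" for S
    using finite_subset[OF that fin(3)] that
  proof (induction S rule: finite_induct)
    case empty
    then show ?case using fin by (simp add: W_def card_gt_0_iff)
  next
    case (insert i S)
    then have pos: "card (W S) > 0" by simp
    have "card (W S) \<le> card (W (insert i S) \<union> (A i \<inter> W S))"
      using fin by (intro card_mono) (auto simp: W_def)
    also have "\<dots> \<le> card (W (insert i S)) + card (A i \<inter> W S)"
      by (rule card_Un_le)
    finally have "real (card (W S)) \<le> card (W (insert i S)) + real (card (A i \<inter> W S))"
      by linarith
    moreover have "card (A i \<inter> W S) \<le> 2 * p * card (W S)"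
      using cond[of S] insert.prems by simp
    moreover have "4 * p * real (card (W S)) \<le> 1 * real (card (W S))"
      using \<open>4 * p \<le> 1\<close> by (intro mult_right_mono) auto
    ultimately show ?case using pos by linarith
  qed
  from this[of I] show ?thesis by (force simp: W_def)
qed

section \<open>Permutations with forbidden set images\<close>

text \<open>A bijection \<open>g\<close> and its inverse exchange \<open>b - b'\<close> with
  \<open>b' - b\<close>; everything else stays fixed. The exchange is kept this small so that
  constraints on sets disjoint from \<open>b\<close> can be transported along it.\<close>

lemma swap_equicardinal_sets:
  assumes "finite b" "finite b'" "card b = card b'"
  obtains \<tau> where "\<tau> permutes b \<union> b'" "\<tau> ` b = b'" "\<tau> ` (b' - b) \<subseteq> b"
    "\<And>x. x \<notin> b \<Longrightarrow> x \<notin> b' \<Longrightarrow> \<tau> x = x"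
proof -
  have "card (b - b') = card (b' - b)"
    using assms by (metis card_le_sym_Diff le_antisym order_refl)
  then obtain g where g: "bij_betw g (b - b') (b' - b)"
    using assms by (metis finite_Diff finite_same_card_bij)
  define h where "h = inv_into (b - b') g"
  have h: "bij_betw h (b' - b) (b - b')"
    unfolding h_def by (rule bij_betw_inv_into[OF g])
  define \<tau> where "\<tau> x = (if x \<in> b - b' then g x else if x \<in> b' - b then h x else x)" for x
  have 1: "bij_betw \<tau> (b - b') (b' - b)"
    using g by (subst bij_betw_cong[of _ _ g]) (auto simp: \<tau>_def)
  have 2: "bij_betw \<tau> (b' - b) (b - b')"
    using h by (subst bij_betw_cong[of _ _ h]) (auto simp: \<tau>_def)
  have 3: "bij_betw \<tau> (b \<inter> b') (b \<inter> b')"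
    by (subst bij_betw_cong[of _ _ id]) (auto simp: \<tau>_def)
  have 4: "bij_betw \<tau> ((b - b') \<union> (b \<inter> b')) ((b' - b) \<union> (b \<inter> b'))"
    by (rule bij_betw_combine[OF 1 3]) auto
  have 5: "bij_betw \<tau> ((b - b') \<union> (b \<inter> b') \<union> (b' - b)) ((b' - b) \<union> (b \<inter> b') \<union> (b - b'))"
    by (rule bij_betw_combine[OF 4 2]) auto
  have "(b - b') \<union> (b \<inter> b') \<union> (b' - b) = b \<union> b'" "(b' - b) \<union> (b \<inter> b') \<union> (b - b') = b \<union> b'"
    by auto
  with 5 have "\<tau> permutes b \<union> b'"
    by (intro bij_imp_permutes) (auto simp: \<tau>_def)
  moreover have "(b - b') \<union> (b \<inter> b') = b" "(b' - b) \<union> (b \<inter> b') = b'"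
    by auto
  with 4 have "\<tau> ` b = b'" by (simp add: bij_betw_def)
  moreover have "\<tau> ` (b' - b) \<subseteq> b"
    using 2 by (auto simp: bij_betw_def)
  ultimately show thesis
    by (intro that[of \<tau>]) (auto simp: \<tau>_def)
qed

text \<open>Negative dependence: composing with the exchange of \<open>b\<close> and
  \<open>b'\<close> injects the first set into the second. Only non-neighbouring constraints occur
  in \<open>S\<close>, and these survive the composition.\<close>

lemma permutation_events_lopsided:
  assumes X: "finite X" "P \<subseteq> X" "b \<subseteq> X" "b' \<subseteq> X" "card b = card b'"
    and S: "\<And>Q c. (Q, c) \<in> S \<Longrightarrow> Q \<inter> P = {} \<and> c \<inter> b = {}"
  shows "card {\<pi>. \<pi> permutes X \<and> \<pi> ` P = b \<and> (\<forall>(Q, c)\<in>S. \<pi> ` Q \<noteq> c)}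
    \<le> card {\<pi>. \<pi> permutes X \<and> \<pi> ` P = b' \<and> (\<forall>(Q, c)\<in>S. \<pi> ` Q \<noteq> c)}"
proof -
  have "finite b" "finite b'" using X by (auto intro: finite_subset)
  then obtain \<tau> where \<tau>: "\<tau> permutes b \<union> b'" "\<tau> ` b = b'" "\<tau> ` (b' - b) \<subseteq> b"
    and fixed: "\<And>x. x \<notin> b \<Longrightarrow> x \<notin> b' \<Longrightarrow> \<tau> x = x"
    using X(5) by (metis swap_equicardinal_sets)
  have \<tau>X: "\<tau> permutes X" using \<tau>(1) X by (meson permutes_subset Un_least)
  show ?thesis
  proof (rule card_inj_on_le[where f = "\<lambda>\<pi>. \<tau> \<circ> \<pi>"])
    show "inj_on ((\<circ>) \<tau>) {\<pi>. \<pi> permutes X \<and> \<pi> ` P = b \<and> (\<forall>(Q, c)\<in>S. \<pi> ` Q \<noteq> c)}"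
      using permutes_inj[OF \<tau>X] by (auto simp: inj_on_def fun_eq_iff inj_def)
    show "finite {\<pi>. \<pi> permutes X \<and> \<pi> ` P = b' \<and> (\<forall>(Q, c)\<in>S. \<pi> ` Q \<noteq> c)}"
      by (rule finite_subset[OF _ finite_permutations[OF X(1)]]) auto
    show "(\<circ>) \<tau> ` {\<pi>. \<pi> permutes X \<and> \<pi> ` P = b \<and> (\<forall>(Q, c)\<in>S. \<pi> ` Q \<noteq> c)}
      \<subseteq> {\<pi>. \<pi> permutes X \<and> \<pi> ` P = b' \<and> (\<forall>(Q, c)\<in>S. \<pi> ` Q \<noteq> c)}"
    proof clarify
      fix \<pi> assume \<pi>: "\<pi> permutes X" "b = \<pi> ` P" "\<forall>(Q, c)\<in>S. \<pi> ` Q \<noteq> c"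
      have "(\<tau> \<circ> \<pi>) ` Q \<noteq> c" if Qc: "(Q, c) \<in> S" for Q c
      proof
        assume eq: "(\<tau> \<circ> \<pi>) ` Q = c"
        \<comment> \<open>\<open>\<pi> x\<close> avoids \<open>b\<close> because \<open>Q\<close>
          misses \<open>P\<close>. It also avoids \<open>b'\<close>, since otherwise
          \<open>\<tau>\<close> would send it into \<open>b\<close>, whereas its image lies in
          \<open>c\<close>, which misses \<open>b\<close>. Hence \<open>\<tau>\<close> leaves the
          image of \<open>Q\<close> unchanged.\<close>
        have "\<tau> (\<pi> x) = \<pi> x" if "x \<in> Q" for x
        proof (rule fixed)
          show "\<pi> x \<notin> b"
            using S[OF Qc] that \<pi>(2) permutes_inj[OF \<pi>(1)] by (auto simp: inj_def)
          moreover have "\<tau> (\<pi> x) \<notin> b" using eq that S[OF Qc] by auto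
          ultimately show "\<pi> x \<notin> b'" using \<tau>(3) by blast
        qed
        then have "(\<tau> \<circ> \<pi>) ` Q = \<pi> ` Q" by auto
        then show False using \<pi>(3) Qc eq by auto
      qed
      then show "\<tau> \<circ> \<pi> permutes X \<and> (\<tau> \<circ> \<pi>) ` P = b' \<and> (\<forall>(Q, c)\<in>S. (\<tau> \<circ> \<pi>) ` Q \<noteq> c)"
        using permutes_compose[OF \<pi>(1) \<tau>X] \<tau>(2) \<pi>(2) by (auto simp: image_comp [symmetric])
    qed
  qed
qed

text \<open>The image of \<open>P\<close> under a uniform permutation of \<open>X\<close> is a
  uniform k-subset, so each event has probability 1 / (card X choose k). Two pairs are neighbours
  when their first or their second components meet.\<close>

lemma permutation_avoiding_set_images:
  fixes E :: "('a set \<times> 'a set) set" and d :: nat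
  assumes X: "finite X"
    and E: "\<And>P b. (P, b) \<in> E \<Longrightarrow> P \<subseteq> X \<and> b \<subseteq> X \<and> card P = k \<and> card b = k"
    and deg: "\<And>P b. (P, b) \<in> E \<Longrightarrow> card {(Q, c) \<in> E. Q \<inter> P \<noteq> {} \<or> c \<inter> b \<noteq> {}} \<le> d"
    and d: "0 < d" "4 * d \<le> card X choose k"
  obtains \<pi> where "\<pi> permutes X" "\<And>P b. (P, b) \<in> E \<Longrightarrow> \<pi> ` P \<noteq> b"
proof -
  define \<Omega> where "\<Omega> = {\<pi>. \<pi> permutes X}"
  define A where "A = (\<lambda>(P, b). {\<pi> \<in> \<Omega>. \<pi> ` P = b})"
  define nb where "nb = (\<lambda>(P, b). {(Q, c). Q \<inter> P \<noteq> {} \<or> c \<inter> b \<noteq> {}} :: ('a set \<times> 'a set) set)"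
  let ?N = "card X choose k"
  have N: "?N > 0" using d by linarith
  have fin\<Omega>: "finite \<Omega>" unfolding \<Omega>_def by (rule finite_permutations[OF X])
  have "\<Omega> - \<Union>(A ` E) \<noteq> {}"
  proof (rule lopsided_local_lemma[where p = "1 / ?N" and d = d and nb = nb, OF fin\<Omega>])
    show "\<Omega> \<noteq> {}" using permutes_id[of X] unfolding \<Omega>_def by blast
    show "finite E"
      by (rule finite_subset[of _ "Pow X \<times> Pow X"]) (use E X in \<open>auto dest!: E\<close>)
    have "4 * real d \<le> ?N" using d(2) by linarith
    then show "4 * (1 / ?N) * d \<le> 1" using N by (simp add: field_simps)
    show "0 < d" "0 \<le> 1 / real ?N" using d by auto
    show "card (nb i \<inter> E) \<le> d" if "i \<in> E" for i
    proof (cases i)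
      case (Pair P b)
      then have "nb i \<inter> E = {(Q, c) \<in> E. Q \<inter> P \<noteq> {} \<or> c \<inter> b \<noteq> {}}"
        by (auto simp: nb_def)
      with deg that Pair show ?thesis by simp
    qed
    show "card (A i \<inter> (\<Omega> - \<Union>(A ` S))) \<le> 1 / ?N * card (\<Omega> - \<Union>(A ` S))"
      if "i \<in> E" and "S \<subseteq> E - nb i" for i S
    proof (cases i)
      case (Pair P b)
      define K where "K = {b'. b' \<subseteq> X \<and> card b' = k}"
      define F where "F b' = {\<pi>. \<pi> permutes X \<and> \<pi> ` P = b' \<and> (\<forall>(Q, c)\<in>S. \<pi> ` Q \<noteq> c)}" for b'
      have Pb: "P \<subseteq> X" "b \<subseteq> X" "card P = k" "card b = k" using E Pair that by auto
      have finK: "finite K" using X by (simp add: K_def)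
      have finF: "finite (F b')" for b'
        by (rule finite_subset[OF _ fin\<Omega>]) (auto simp: F_def \<Omega>_def)
      have AF: "A i \<inter> (\<Omega> - \<Union>(A ` S)) = F b"
        by (force simp: F_def A_def \<Omega>_def Pair)
      have "\<pi> ` P \<in> K" if "\<pi> permutes X" for \<pi>
        using that Pb permutes_image[OF that] card_image[OF permutes_inj_on[OF that]]
        by (auto simp: K_def)
      then have WF: "\<Omega> - \<Union>(A ` S) = (\<Union>b'\<in>K. F b')"
        by (force simp: F_def A_def \<Omega>_def)
      \<comment> \<open>The classes \<open>F b'\<close> partition the avoiding permutations
        according to the image of \<open>P\<close>. The class of \<open>b\<close> is a smallest one,
        so it holds at most a 1/\<open>?N\<close> share.\<close>
      have "card (F b) \<le> card (F b')" if "b' \<in> K" for b'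
        unfolding F_def using that Pb X \<open>S \<subseteq> E - nb i\<close> Pair
        by (intro permutation_events_lopsided) (auto simp: K_def nb_def)
      then have "?N * card (F b) \<le> (\<Sum>b'\<in>K. card (F b'))"
        using sum_mono[of K "\<lambda>_. card (F b)" "\<lambda>b'. card (F b')"] n_subsets[OF X, of k]
        by (simp add: K_def)
      also have "\<dots> = card (\<Omega> - \<Union>(A ` S))"
        unfolding WF by (rule card_UN_disjoint[symmetric]) (use finK finF in \<open>auto simp: F_def\<close>)
      finally have "real ?N * card (F b) \<le> card (\<Omega> - \<Union>(A ` S))"
        by (metis of_nat_le_iff of_nat_mult)
      then show ?thesis using N unfolding AF by (simp add: field_simps)
    qed
  qed
  then obtain \<pi> where "\<pi> \<in> \<Omega>" "\<pi> \<notin> \<Union>(A ` E)" by auto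
  then show thesis
    by (intro that[of \<pi>]) (auto simp: \<Omega>_def A_def)
qed

section \<open>Counting blocks and subsets of windows\<close>

lemma card_subsets_containing_le:
  assumes "finite X" "1 \<le> m" "\<F> \<subseteq> {T. x \<in> T \<and> T \<subseteq> insert x X \<and> card T = m}"
  shows "card \<F> \<le> card X ^ (m - 1)"
proof -
  let ?G = "{T. T \<subseteq> X \<and> card T = m - 1}"
  have "card \<F> \<le> card ?G"
  proof (rule card_inj_on_le[where f = "\<lambda>T. T - {x}"])
    show "inj_on (\<lambda>T. T - {x}) \<F>"
      using assms(3) by (intro inj_onI) (metis (no_types, lifting) insert_Diff mem_Collect_eq subsetD)
    show "(\<lambda>T. T - {x}) ` \<F> \<subseteq> ?G"
      using assms by (auto simp: subset_iff)
  qed (use assms in auto)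
  also have "\<dots> = card X choose (m - 1)"
    by (rule n_subsets[OF assms(1)])
  also have "\<dots> \<le> card X ^ (m - 1)"
    \<comment> \<open>The binomial coefficient vanishes when \<open>m - 1\<close> exceeds
      \<open>card X\<close>.\<close>
    by (cases "m - 1 \<le> card X") (auto simp: binomial_le_pow binomial_eq_0)
  finally show ?thesis .
qed

lemma card_blocks_le:
  assumes fin: "finite \<T>" "finite B"
    and cover: "\<And>b. b \<in> B \<Longrightarrow> \<exists>T\<in>\<T>. T \<subseteq> b"
    and lam: "\<And>T. T \<in> \<T> \<Longrightarrow> card {b\<in>B. T \<subseteq> b} \<le> lam"
  shows "card B \<le> lam * card \<T>"
proof -
  have "card B \<le> card (\<Union>T\<in>\<T>. {b\<in>B. T \<subseteq> b})"
    using cover fin by (intro card_mono) auto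
  also have "\<dots> \<le> (\<Sum>T\<in>\<T>. card {b\<in>B. T \<subseteq> b})"
    by (rule card_UN_le[OF fin(1)])
  also have "\<dots> \<le> (\<Sum>T\<in>\<T>. lam)"
    by (rule sum_mono) (rule lam)
  finally show ?thesis by (simp add: mult.commute)
qed

text \<open>Every block through \<open>x\<close> contains a t-set through \<open>x\<close>. There
  are at most n^(t-1) such t-sets, each in at most \<open>lam\<close> blocks.\<close>

lemma partial_system_degree_le:
  assumes ps: "partial_system n k t lam X B"
  shows "card {b\<in>B. x \<in> b} \<le> lam * n ^ (t - 1)"
proof (cases "x \<in> X")
  case True
  note ps' = ps[unfolded partial_system_def]
  let ?T = "{T. x \<in> T \<and> T \<subseteq> X \<and> card T = t}"
  have finB: "finite B" by (rule finite_subset[of _ "Pow X"]) (use ps' in auto)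
  have "card {b\<in>B. x \<in> b} \<le> lam * card ?T"
  proof (rule card_blocks_le)
    show "finite ?T" using ps' by simp
    show "\<exists>T\<in>?T. T \<subseteq> b" if "b \<in> {b\<in>B. x \<in> b}" for b
    proof -
      have b: "x \<in> b" "b \<subseteq> X" "card b = k" using that ps' by auto
      then obtain T where "{x} \<subseteq> T" "T \<subseteq> b" "card T = t"
        using exists_subset_between[of "{x}" t b] ps' finite_subset[of b X] by auto
      then show ?thesis using b by auto
    qed
    show "card {b \<in> {b \<in> B. x \<in> b}. T \<subseteq> b} \<le> lam" if "T \<in> ?T" for T
    proof -
      have "{b \<in> {b \<in> B. x \<in> b}. T \<subseteq> b} = {b\<in>B. T \<subseteq> b}" using that by auto
      then show ?thesis using that ps' by auto
    qed
  qed (use finB in auto)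
  also have "card ?T \<le> card X ^ (t - 1)"
    by (rule card_subsets_containing_le[where x = x]) (use ps' in auto)
  finally show ?thesis using ps' by auto
next
  case False
  then have "{b\<in>B. x \<in> b} = {}" using ps by (auto simp: partial_system_def)
  then show ?thesis by (metis card.empty zero_le)
qed

text \<open>A union bound with two uses: \<open>Y\<close> the whole vertex set bounds the size of a
  family, and \<open>Y\<close> a single k-set bounds the number of members meeting it.\<close>

lemma card_le_sum_containing:
  assumes "finite Y" "finite \<F>" "\<And>S. S \<in> \<F> \<Longrightarrow> S \<inter> Y \<noteq> {}"
    and "\<And>x. x \<in> Y \<Longrightarrow> card {S\<in>\<F>. x \<in> S} \<le> c"
  shows "card \<F> \<le> card Y * c"
proof -
  have "card \<F> \<le> card (\<Union>x\<in>Y. {S\<in>\<F>. x \<in> S})"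
    using assms by (intro card_mono) auto
  also have "\<dots> \<le> (\<Sum>x\<in>Y. card {S\<in>\<F>. x \<in> S})"
    by (rule card_UN_le[OF assms(1)])
  also have "\<dots> \<le> (\<Sum>x\<in>Y. c)"
    by (rule sum_mono) (rule assms(4))
  finally show ?thesis by simp
qed

text \<open>All windows through \<open>x\<close> lie within cyclic distance less than
  \<open>l\<close> of its position, so the other \<open>k - 1\<close> points come from one set of at
  most 2l vertices, whichever window is used.\<close>

lemma card_window_subsets_containing_le:
  assumes "bij_betw \<phi> {0..<n} X" "x \<in> X" "1 \<le> k"
  shows "card {P. x \<in> P \<and> card P = k \<and> (\<exists>i<n. P \<subseteq> cyc_window n \<phi> i l)} \<le> (2 * l) ^ (k - 1)"
proof -
  obtain p where p: "p < n" "x = \<phi> p"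
    using assms by (auto simp: bij_betw_def)
  \<comment> \<open>Offsets are integers because the difference of two places in a window may be
    negative; \<open>mod\<close> then wraps around the cycle.\<close>
  define V where "V = (\<lambda>j. \<phi> (nat ((int p + j) mod int n))) ` {- int l..<int l}"
  have "P \<subseteq> V" if P: "x \<in> P" "i < n" "P \<subseteq> cyc_window n \<phi> i l" for P i
  proof
    fix y assume "y \<in> P"
    then obtain j where j: "j < l" "y = \<phi> ((i + j) mod n)"
      using P(3) by (auto simp: cyc_window_def)
    obtain j' where j': "j' < l" "\<phi> p = \<phi> ((i + j') mod n)"
      using P(1,3) p(2) by (auto simp: cyc_window_def)
    have "p = (i + j') mod n"
      using assms(1) j'(2) p(1) by (auto simp: bij_betw_def inj_on_def)
    then have "int p = (int i + int j') mod int n"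
      by (simp add: of_nat_mod)
    then have "(int p + (int j - int j')) mod int n = (int i + int j' + (int j - int j')) mod int n"
      by (simp only: mod_add_left_eq)
    also have "\<dots> = int ((i + j) mod n)"
      by (simp add: of_nat_mod)
    finally have "y = \<phi> (nat ((int p + (int j - int j')) mod int n))"
      using j by simp
    then show "y \<in> V"
      unfolding V_def using j(1) j'(1) by (intro image_eqI[of _ _ "int j - int j'"]) auto
  qed
  then have "card {P. x \<in> P \<and> card P = k \<and> (\<exists>i<n. P \<subseteq> cyc_window n \<phi> i l)} \<le> card V ^ (k - 1)"
    using assms(3) by (intro card_subsets_containing_le[where x = x]) (auto simp: V_def)
  also have "card V \<le> 2 * l"
    unfolding V_def by (rule order_trans[OF card_image_le]) auto
  finally show ?thesis by (simp add: power_mono)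
qed

section \<open>Local lemma applied to sequencings\<close>

lemma cyclically_good_exists:
  assumes ps: "partial_system n k t lam X B" and l: "0 < l"
    and large: "8 * k * lam * n ^ t * (2 * l) ^ (k - 1) \<le> n choose k"
  shows "\<exists>\<phi>. cyclically_good n X B \<phi> l"
proof -
  note ps' = ps[unfolded partial_system_def]
  have X: "finite X" "card X = n" using ps' by auto
  have B: "b \<subseteq> X" "card b = k" if "b \<in> B" for b using ps' that by auto
  have finB: "finite B" by (rule finite_subset[of _ "Pow X"]) (use B X in auto)
  have kt: "2 \<le> t" "t < k" "0 < lam" "k \<le> n" using ps' by auto
  obtain \<phi> where \<phi>: "bij_betw \<phi> {0..<n} X"
    using ex_bij_betw_nat_finite[OF X(1)] X(2) by auto
  have winX: "cyc_window n \<phi> i l \<subseteq> X" if "i < n" for i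
    using \<phi> that by (auto simp: cyc_window_def bij_betw_def)
  \<comment> \<open>Positions are named by the vertices that the reference sequencing
    \<open>\<phi>\<close> puts there. A random sequencing thus becomes a random permutation of
    \<open>X\<close> after \<open>\<phi>\<close>, and positions and blocks are subsets of the same
    set.\<close>
  define \<P> where "\<P> = {P. card P = k \<and> (\<exists>i<n. P \<subseteq> cyc_window n \<phi> i l)}"
  have \<P>X: "P \<subseteq> X" "card P = k" if "P \<in> \<P>" for P using that winX by (auto simp: \<P>_def)
  have fin\<P>: "finite \<P>" by (rule finite_subset[of _ "Pow X"]) (use \<P>X X in auto)
  have nonempty: "S \<inter> X \<noteq> {}" if "S \<subseteq> X" "card S = k" for S
    using that kt X(1) by (cases "S = {}") auto
  let ?w = "(2 * l) ^ (k - 1)" and ?e = "lam * n ^ (t - 1)"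
  have cont\<P>: "card {P\<in>\<P>. x \<in> P} \<le> ?w" if "x \<in> X" for x
  proof -
    have "{P\<in>\<P>. x \<in> P} = {P. x \<in> P \<and> card P = k \<and> (\<exists>i<n. P \<subseteq> cyc_window n \<phi> i l)}"
      by (auto simp: \<P>_def)
    then show ?thesis using card_window_subsets_containing_le[OF \<phi> that] kt by simp
  qed
  have contB: "card {b\<in>B. x \<in> b} \<le> ?e" for x
    by (rule partial_system_degree_le[OF ps])
  have card\<P>: "card \<P> \<le> n * ?w"
    using card_le_sum_containing[OF X(1) fin\<P> _ cont\<P>] nonempty \<P>X X by auto
  have cardB: "card B \<le> n * ?e"
    using card_le_sum_containing[OF X(1) finB _ contB] nonempty B X by auto
  have meet\<P>: "card {Q\<in>\<P>. Q \<inter> P \<noteq> {}} \<le> k * ?w" if "P \<subseteq> X" "card P = k" for P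
  proof -
    have "card {Q\<in>\<P>. Q \<inter> P \<noteq> {}} \<le> card P * ?w"
    proof (rule card_le_sum_containing)
      fix x assume "x \<in> P"
      then have "{S \<in> {Q\<in>\<P>. Q \<inter> P \<noteq> {}}. x \<in> S} = {Q\<in>\<P>. x \<in> Q}" "x \<in> X"
        using that by auto
      then show "card {S \<in> {Q\<in>\<P>. Q \<inter> P \<noteq> {}}. x \<in> S} \<le> ?w" using cont\<P> by simp
    qed (use fin\<P> that X finite_subset in auto)
    then show ?thesis using that by simp
  qed
  have meetB: "card {c\<in>B. c \<inter> b \<noteq> {}} \<le> k * ?e" if "b \<subseteq> X" "card b = k" for b
  proof -
    have "card {c\<in>B. c \<inter> b \<noteq> {}} \<le> card b * ?e"
    proof (rule card_le_sum_containing)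
      fix x assume "x \<in> b"
      then have "{S \<in> {c\<in>B. c \<inter> b \<noteq> {}}. x \<in> S} = {c\<in>B. x \<in> c}" by auto
      then show "card {S \<in> {c\<in>B. c \<inter> b \<noteq> {}}. x \<in> S} \<le> ?e" using contB by simp
    qed (use finB that X finite_subset in auto)
    then show ?thesis using that by simp
  qed
  \<comment> \<open>The factor 2 counts two equal contributions: pairs whose position set meets
    \<open>P\<close>, and pairs whose block meets \<open>b\<close>. Each is at most k * lam * n^t *
    (2l)^(k-1).\<close>
  define d where "d = 2 * k * lam * n ^ t * ?w"
  have nt: "n * n ^ (t - 1) = n ^ t" using kt by (cases t) auto
  have deg: "card {(Q, c) \<in> \<P> \<times> B. Q \<inter> P \<noteq> {} \<or> c \<inter> b \<noteq> {}} \<le> d"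
    if "(P, b) \<in> \<P> \<times> B" for P b
  proof -
    have Pb: "P \<subseteq> X" "card P = k" "b \<subseteq> X" "card b = k" using that \<P>X B by auto
    let ?M = "{Q\<in>\<P>. Q \<inter> P \<noteq> {}}" and ?L = "{c\<in>B. c \<inter> b \<noteq> {}}"
    have "card {(Q, c) \<in> \<P> \<times> B. Q \<inter> P \<noteq> {} \<or> c \<inter> b \<noteq> {}} \<le> card (?M \<times> B \<union> \<P> \<times> ?L)"
      using fin\<P> finB by (intro card_mono) auto
    also have "\<dots> \<le> card ?M * card B + card \<P> * card ?L"
      by (rule order_trans[OF card_Un_le]) (simp add: card_cartesian_product)
    also have "\<dots> \<le> (k * ?w) * (n * ?e) + (n * ?w) * (k * ?e)"
      by (intro add_mono mult_mono meet\<P> meetB cardB card\<P> Pb) auto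
    also have "\<dots> = 2 * k * lam * (n * n ^ (t - 1)) * ?w" by simp
    also have "\<dots> = d" by (simp only: nt d_def)
    finally show ?thesis .
  qed
  have "0 < d" using kt l by (simp add: d_def)
  have "4 * d \<le> card X choose k" using large X by (simp add: d_def mult_ac)
  obtain \<pi> where \<pi>: "\<pi> permutes X" "\<And>P b. (P, b) \<in> \<P> \<times> B \<Longrightarrow> \<pi> ` P \<noteq> b"
    by (rule permutation_avoiding_set_images[OF X(1), of "\<P> \<times> B" k d])
      (use \<P>X B deg \<open>0 < d\<close> \<open>4 * d \<le> card X choose k\<close> in auto)
  have window: "cyc_window n (\<pi> \<circ> \<phi>) i l = \<pi> ` cyc_window n \<phi> i l" for i
    by (simp add: cyc_window_def image_comp)
  have "cyclically_good n X B (\<pi> \<circ> \<phi>) l"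
    unfolding cyclically_good_def sequencing_def independent_set_def window
  proof (intro conjI allI impI ballI)
    show "bij_betw (\<pi> \<circ> \<phi>) {0..<n} X"
      using \<phi> permutes_imp_bij[OF \<pi>(1)] by (rule bij_betw_trans)
    fix i assume i: "i < n"
    show "\<pi> ` cyc_window n \<phi> i l \<subseteq> X"
      using winX[OF i] permutes_image[OF \<pi>(1)] by blast
    fix b assume b: "b \<in> B"
    show "\<not> b \<subseteq> \<pi> ` cyc_window n \<phi> i l"
    proof
      assume "b \<subseteq> \<pi> ` cyc_window n \<phi> i l"
      \<comment> \<open>A block inside a window is the image of a k-set of positions in that window,
        which is exactly a forbidden event.\<close>
      then obtain P where P: "P \<subseteq> cyc_window n \<phi> i l" "b = \<pi> ` P"
        by (meson subset_imageE)
      then have "card P = k"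
        using B(2)[OF b] card_image[OF permutes_inj_on[OF \<pi>(1)]] by metis
      then show False using \<pi>(2)[of P b] P b i by (auto simp: \<P>_def)
    qed
  qed
  then show ?thesis by blast
qed

section \<open>Asymptotic comparison\<close>

text \<open>With s = n^(1/t), the left side is of order s^(t^2+k-1), while \<open>n choose k\<close>
  is at least (n/k)^k = s^(tk) / k^k. The spare factor s absorbs all constants.\<close>

lemma eventually_local_lemma_condition:
  fixes \<alpha> :: real
  assumes "2 \<le> t" "t + 2 \<le> k" "0 < \<alpha>"
  shows "\<exists>N. \<forall>n\<ge>N. \<forall>l. k \<le> n \<and> real l \<le> \<alpha> * real n powr (1 / real t) \<longrightarrow>
    8 * k * lam * n ^ t * (2 * l) ^ (k - 1) \<le> n choose k"
proof -
  \<comment> \<open>\<open>C\<close> collects all constants, including the k^k from the lower bound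
    on the binomial coefficient.\<close>
  define C where "C = 8 * real k * lam * (2 * \<alpha>) ^ (k - 1) * real k ^ k"
  \<comment> \<open>A natural number above \<open>C\<close>, so that n at least c^t gives s at least
    \<open>C\<close>; the added 1 also yields s at least 1, needed for monotonicity in the
    exponent.\<close>
  define c where "c = nat \<lceil>C\<rceil> + 1"
  show ?thesis
  proof (intro exI[of _ "c ^ t"] allI impI)
    fix n l assume n: "c ^ t \<le> n" and asm: "k \<le> n \<and> real l \<le> \<alpha> * real n powr (1 / real t)"
    define s where "s = real n powr (1 / real t)"
    have n0: "0 < n" "0 < k" using asm assms by auto
    have st: "s ^ t = n" using n0 assms by (simp add: s_def powr_powr flip: powr_realpow)
    have "real c ^ t \<le> s ^ t" using n st by (metis of_nat_le_iff of_nat_power)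
    then have cs: "real c \<le> s" using assms by (simp add: s_def power_mono_iff)
    have "C \<le> c" unfolding c_def by linarith
    then have Cs: "C \<le> s" "1 \<le> s" using cs by (auto simp: c_def)
    \<comment> \<open>For k = t + 2 + a the difference of the two sides is (t - 2) + a(t - 1); it is
      zero for t = 2, k = 4.\<close>
    have exponent: "t * t + (k - 1) + 1 \<le> t * k"
    proof -
      obtain a where a: "k = t + 2 + a" using assms(2) le_Suc_ex by blast
      obtain u where u: "t = 2 + u" using assms(1) le_Suc_ex by blast
      show ?thesis unfolding a u by (simp add: algebra_simps)
    qed
    have "real (8 * k * lam * n ^ t * (2 * l) ^ (k - 1))
        = 8 * real k * lam * (s ^ t) ^ t * (2 * real l) ^ (k - 1)"
      by (simp add: st)
    also have "\<dots> \<le> 8 * real k * lam * (s ^ t) ^ t * (2 * (\<alpha> * s)) ^ (k - 1)"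
      using asm Cs by (intro mult_left_mono power_mono) (auto simp: s_def)
    also have "\<dots> = C * s ^ (t * t + (k - 1)) / real k ^ k"
    proof -
      have "s ^ (t * t + (k - 1)) = (s ^ t) ^ t * s ^ (k - 1)"
        by (simp only: power_add power_mult)
      then show ?thesis using n0 by (simp add: C_def power_mult_distrib)
    qed
    also have "\<dots> \<le> s * s ^ (t * t + (k - 1)) / real k ^ k"
      using Cs by (intro divide_right_mono mult_right_mono) auto
    also have "\<dots> = s ^ (t * t + (k - 1) + 1) / real k ^ k"
      by simp
    also have "\<dots> \<le> s ^ (t * k) / real k ^ k"
      using Cs exponent by (intro divide_right_mono power_increasing) auto
    also have "\<dots> = (real n / real k) ^ k"
      by (simp add: power_mult st power_divide)
    also have "\<dots> \<le> real (n choose k)"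
      using binomial_ge_n_over_k_pow_k[of k n] asm by simp
    finally show "8 * k * lam * n ^ t * (2 * l) ^ (k - 1) \<le> n choose k"
      by (simp only: of_nat_le_iff)
  qed
qed

theorem theorem2:
  fixes k t lam :: nat and \<alpha> :: real
  assumes "2 \<le> t" and "t + 2 \<le> k" and "0 < lam" and "0 < \<alpha>"
    and "\<alpha> < ((\<Prod>i=1..t. real (k - i)) / (real lam * (2 ^ (t + 1) - 1))) powr (1 / real t)"
  shows "\<exists>N. \<forall>n\<ge>N. \<forall>(X :: 'a set) B. partial_system n k t lam X B \<longrightarrow>
           (\<forall>l::nat. 0 < l \<and> real l \<le> \<alpha> * real n powr (1 / real t) \<longrightarrow>
              (\<exists>\<phi>. cyclically_good n X B \<phi> l))"
proof -
  obtain N where N: "8 * k * lam * n ^ t * (2 * l) ^ (k - 1) \<le> n choose k"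
    if "N \<le> n" "k \<le> n" "real l \<le> \<alpha> * real n powr (1 / real t)" for n l
    using eventually_local_lemma_condition[OF assms(1,2,4)] by blast
  \<comment> \<open>The threshold \<open>N\<close> is fixed before the system and \<open>l\<close>;
    the remaining side condition comes from the system itself.\<close>
  have "k \<le> n" if "partial_system n k t lam X B" for n and X :: "'a set" and B
    using that by (simp add: partial_system_def)
  then show ?thesis
    using N cyclically_good_exists by (intro exI[of _ N]) blast
qed

end
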